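(* Let $\mathbf{g}=(g_1,\dots,g_m)^T:\mathbb{C}^n\to\mathbb{C}^m$ be real-analytic (not necessarily holomorphic), let $\mathbf{y}\in\mathbb{C}^m$, let $W\in\mathbb{C}^{m\times m}$ be Hermitian positive definite, and let $$\ell(\mathbf{z})=\tfrac12\left(\mathbf{y}-\mathbf{g}(\mathbf{z})\right)^HW\left(\mathbf{y}-\mathbf{g}(\mathbf{z})\right),\qquad \mathbf{e}=\mathbf{y}-\mathbf{g}(\mathbf{z}),\qquad G=\frac{\partial\mathbf{g}}{\partial\mathbf{c}}\in\mathbb{C}^{m\times 2n}.$$ Then, at every point of $\mathbb{C}^n$, the Hessian $\mathcal{H}^{\mathbb{C}}_{\mathbf{c}\mathbf{c}}=\frac{\partial}{\partial\mathbf{c}}\left(\frac{\partial\ell}{\partial\mathbf{c}}\right)^H$ of $\ell$ satisfies $$\mathcal{H}^{\mathbb{C}}_{\mathbf{c}\mathbf{c}}=\mathbf{P}\left(G^HWG\right)-\sum_{i=1}^m\mathcal{H}^{(i)}_{\mathbf{c}\mathbf{c}},\qquad \mathcal{H}^{(i)}_{\mathbf{c}\mathbf{c}}=\mathbf{P}\left([W\mathbf{e}]_i\,\frac{\partial}{\partial\mathbf{c}}\left(\frac{\partial g_i}{\partial\mathbf{c}}\right)^H\right),$$ where $[W\mathbf{e}]_i$ is the $i$-th component of $W\mathbf{e}$. Moreover, for each $i=1,\dots,m$, the matrix $\mathcal{H}^{(i)}_{\mathbf{c}\mathbf{c}}$ is Hermitian and maps $\mathcal{C}$ into $\mathcal{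C}$.
   Context: Here $j=\sqrt{-1}$, a bar is entrywise complex conjugation, and ${}^H$ is conjugate transpose. Write $\mathbf{z}=\mathbf{x}+j\mathbf{y}'\in\mathbb{C}^n$ with $\mathbf{x},\mathbf{y}'\in\mathbb{R}^n$, and $\mathbf{c}=(\mathbf{z}^T,\bar{\mathbf{z}}^T)^T$. Define the row operators $\frac{\partial}{\partial\mathbf{z}}=\frac12\left(\frac{\partial}{\partial\mathbf{x}}-j\frac{\partial}{\partial\mathbf{y}'}\right)$, $\frac{\partial}{\partial\bar{\mathbf{z}}}=\frac12\left(\frac{\partial}{\partial\mathbf{x}}+j\frac{\partial}{\partial\mathbf{y}'}\right)$ and $\frac{\partial}{\partial\mathbf{c}}=\left(\frac{\partial}{\partial\mathbf{z}},\frac{\partial}{\partial\bar{\mathbf{z}}}\right)$ (of length $2n$). Applied to a column-vector-valued function $F$, such an operator gives the matrix whose $(k,l)$ entry is the $l$-th component operator applied to $F_k$. $\mathcal{C}=\left\{\begin{pmatrix}\mathbf{w}\\ \bar{\mathbf{w}}\end{pmatrix}:\mathbf{w}\in\mathbb{C}^n\right\}\subset\mathbb{C}^{2n}$. For $M\in\mathbb{C}^{2n\times 2n}$, $\mathbf{P}(M)=\frac12\left(M+S\,\overline{M}\,S\right)$ with $S=\begin{pmatrix}0&I\\ I&0\end{pmatrix}$, $I$ the $n\times n$ identity. *)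

theory Defs
  imports "HOL-Analysis.Analysis"
begin

(* Multi-indices are functions Basis -> nat, extended by 0 outside Basis.  The coordinates
   (x - p) \<bullet> b are taken with respect to the real Euclidean structure of the domain: for
   complex ^ 'n they are the Re (x $ k - p $ k) and Im (x $ k - p $ k), so this is real
   analyticity in the 2n real variables.  In finite dimensions has_sum is absolute
   convergence. *)
definition multi_indices :: "('a::euclidean_space \<Rightarrow> nat) set" where
  "multi_indices = {\<alpha>. \<forall>b. b \<notin> Basis \<longrightarrow> \<alpha> b = 0}"

definition real_analytic_at :: "('a::euclidean_space \<Rightarrow> 'b::euclidean_space) \<Rightarrow> 'a \<Rightarrow> bool" where
  "real_analytic_at f p \<longleftrightarrow>
     (\<exists>r>0. \<exists>a :: ('a \<Rightarrow> nat) \<Rightarrow> 'b. \<forall>x\<in>ball p r.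
        ((\<lambda>\<alpha>. (\<Prod>b\<in>Basis. ((x - p) \<bullet> b) ^ \<alpha> b) *\<^sub>R a \<alpha>) has_sum f x) multi_indices)"

definition real_analytic_on :: "('a::euclidean_space \<Rightarrow> 'b::euclidean_space) \<Rightarrow> 'a set \<Rightarrow> bool" where
  "real_analytic_on f A \<longleftrightarrow> (\<forall>p\<in>A. real_analytic_at f p)"

(* Partial derivatives in the real and imaginary part of the k-th complex coordinate. *)
definition partial_x :: "'n \<Rightarrow> (complex ^ 'n \<Rightarrow> complex) \<Rightarrow> complex ^ 'n \<Rightarrow> complex" where
  "partial_x k f z = vector_derivative (\<lambda>t::real. f (z + axis k (complex_of_real t))) (at 0)"

definition partial_y :: "'n \<Rightarrow> (complex ^ 'n \<Rightarrow> complex) \<Rightarrow> complex ^ 'n \<Rightarrow> complex" where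
  "partial_y k f z = vector_derivative (\<lambda>t::real. f (z + axis k (\<i> * complex_of_real t))) (at 0)"

definition wirtinger :: "'n \<Rightarrow> (complex ^ 'n \<Rightarrow> complex) \<Rightarrow> complex ^ 'n \<Rightarrow> complex" where
  "wirtinger k f z = (1/2) * (partial_x k f z - \<i> * partial_y k f z)"

definition wirtinger_bar :: "'n \<Rightarrow> (complex ^ 'n \<Rightarrow> complex) \<Rightarrow> complex ^ 'n \<Rightarrow> complex" where
  "wirtinger_bar k f z = (1/2) * (partial_x k f z + \<i> * partial_y k f z)"

(* Length 2n is rendered by the index type 'n + 'n: Inl k is the z_k slot, Inr k the slot of
   its conjugate. *)
definition aug_partial :: "'n + 'n \<Rightarrow> (complex ^ 'n \<Rightarrow> complex) \<Rightarrow> complex ^ 'n \<Rightarrow> complex" where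
  "aug_partial l = (case l of Inl k \<Rightarrow> wirtinger k | Inr k \<Rightarrow> wirtinger_bar k)"

definition aug_jacobian ::
    "(complex ^ 'n \<Rightarrow> complex ^ 'k) \<Rightarrow> complex ^ 'n \<Rightarrow> complex ^ ('n + 'n) ^ 'k" where
  "aug_jacobian F z = (\<chi> k l. aug_partial l (\<lambda>w. F w $ k) z)"

definition aug_gradient :: "(complex ^ 'n \<Rightarrow> complex) \<Rightarrow> complex ^ 'n \<Rightarrow> complex ^ ('n + 'n)" where
  "aug_gradient f z = (\<chi> l. aug_partial l f z)"

(* Vectors carry no row/column distinction, so the conjugate transpose of a row vector is its
   entrywise conjugate. *)
definition vec_cnj :: "complex ^ 'k \<Rightarrow> complex ^ 'k" where
  "vec_cnj v = (\<chi> i. cnj (v $ i))"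

definition aug_hessian ::
    "(complex ^ 'n \<Rightarrow> complex) \<Rightarrow> complex ^ 'n \<Rightarrow> complex ^ ('n + 'n) ^ ('n + 'n)" where
  "aug_hessian f = aug_jacobian (\<lambda>z. vec_cnj (aug_gradient f z))"

definition mat_cnj :: "complex ^ 'c ^ 'r \<Rightarrow> complex ^ 'c ^ 'r" where
  "mat_cnj A = (\<chi> i j. cnj (A $ i $ j))"

definition ctranspose :: "complex ^ 'c ^ 'r \<Rightarrow> complex ^ 'r ^ 'c" where
  "ctranspose A = transpose (mat_cnj A)"

(* The product * of the type vec is componentwise, hence a separate scalar multiplication. *)
definition mat_scale :: "complex \<Rightarrow> complex ^ 'c ^ 'r \<Rightarrow> complex ^ 'c ^ 'r" where
  "mat_scale a A = (\<chi> i j. a * A $ i $ j)"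

definition hermitian :: "complex ^ 'k ^ 'k \<Rightarrow> bool" where
  "hermitian A \<longleftrightarrow> ctranspose A = A"

definition sesq :: "complex ^ 'k ^ 'k \<Rightarrow> complex ^ 'k \<Rightarrow> complex" where
  "sesq A v = (\<Sum>i\<in>UNIV. cnj (v $ i) * (A *v v) $ i)"

(* For hermitian A the value of sesq A v is real. *)
definition hermitian_pos_def :: "complex ^ 'k ^ 'k \<Rightarrow> bool" where
  "hermitian_pos_def A \<longleftrightarrow> hermitian A \<and> (\<forall>v. v \<noteq> 0 \<longrightarrow> 0 < Re (sesq A v))"

definition swap_mat :: "complex ^ ('n::finite + 'n) ^ ('n + 'n)" where
  "swap_mat = (\<chi> k l. case (k, l) of
       (Inl i, Inr j) \<Rightarrow> if i = j then 1 else 0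
     | (Inr i, Inl j) \<Rightarrow> if i = j then 1 else 0
     | _ \<Rightarrow> 0)"

definition proj_P :: "complex ^ ('n::finite + 'n) ^ ('n + 'n) \<Rightarrow> complex ^ ('n + 'n) ^ ('n + 'n)" where
  "proj_P M = mat_scale (1/2) (M + swap_mat ** mat_cnj M ** swap_mat)"

definition aug_vec :: "complex ^ 'n \<Rightarrow> complex ^ ('n + 'n)" where
  "aug_vec w = (\<chi> k. case k of Inl i \<Rightarrow> w $ i | Inr i \<Rightarrow> cnj (w $ i))"

definition aug_space :: "(complex ^ ('n::finite + 'n)) set" where
  "aug_space = range aug_vec"

definition residual :: "complex ^ 'm \<Rightarrow> (complex ^ 'n \<Rightarrow> complex ^ 'm) \<Rightarrow> complex ^ 'n \<Rightarrow> complex ^ 'm" where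
  "residual y g z = y - g z"

definition lsq_loss ::
    "complex ^ 'm ^ 'm \<Rightarrow> complex ^ 'm \<Rightarrow> (complex ^ 'n \<Rightarrow> complex ^ 'm) \<Rightarrow> complex ^ 'n \<Rightarrow> complex" where
  "lsq_loss W y g z = (1/2) * sesq W (residual y g z)"

definition residual_hessian ::
    "complex ^ 'm ^ 'm \<Rightarrow> complex ^ 'm \<Rightarrow> (complex ^ 'n \<Rightarrow> complex ^ 'm) \<Rightarrow> 'm \<Rightarrow> complex ^ 'n
      \<Rightarrow> complex ^ ('n + 'n) ^ ('n + 'n)" where
  "residual_hessian W y g i z =
     proj_P (mat_scale ((W *v residual y g z) $ i) (aug_hessian (\<lambda>w. g w $ i) z))"

end

(* Let D_l be the l-th component of the augmented operator and l' the slot conjugate to l.  Since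
   cnj (D_k f) = D_k' (cnj f), the Hessian entries of a function f are D_l D_k' (cnj f).  The loss
   is real because W is Hermitian, so its entries are D_l D_k' applied to it, and the product rule
   gives four sums: the two with first derivatives only are the (k,l) entries of G^H W G and of
   S (cnj (G^H W G)) S, the two with a second derivative are the corresponding entries for the
   residual Hessians.  Hermitian symmetry of the latter is D_l D_k' = D_k' D_l.

   Only derivatives along coordinate lines occur, so no Frechet differentiability is needed.  A
   power series is differentiated term by term along a coordinate, and mixed partial derivatives
   commute because the coefficient shifts do. *)
theory Submission
  imports Defs
begin

section \<open>Power series in several real variables\<close>

text \<open>A remainder of order t^2 is o(t). A quadratic bound suits power series because it can be
  summed over all multi-indices.\<close>

lemma has_vector_derivative_quadratic:
  fixes \<phi> :: "real \<Rightarrow> 'b::real_normed_vector"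
  assumes "\<delta> > 0" and bound: "\<And>t. \<bar>t\<bar> < \<delta> \<Longrightarrow> norm (\<phi> t - \<phi> 0 - t *\<^sub>R D) \<le> C * t\<^sup>2"
  shows "(\<phi> has_vector_derivative D) (at 0)"
  unfolding has_vector_derivative_def has_derivative_at_alt
proof (intro conjI allI impI)
  show "bounded_linear (\<lambda>t. t *\<^sub>R D)"
    by (rule bounded_linear_scaleR_left)
next
  fix e :: real assume "e > 0"
  \<comment> \<open>The added 1 keeps the divisor positive for every real \<open>C\<close>.\<close>
  define d where "d = min \<delta> (e / (\<bar>C\<bar> + 1))"
  have "d > 0"
    unfolding d_def using \<open>\<delta> > 0\<close> \<open>e > 0\<close> by simp
  moreover have "norm (\<phi> t - \<phi> 0 - (t - 0) *\<^sub>R D) \<le> e * norm (t - 0)" if "norm (t - 0) < d" for t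
  proof -
    have "(\<bar>C\<bar> + 1) * \<bar>t\<bar> \<le> e"
      using that by (auto simp: d_def field_simps)
    then have "(\<bar>C\<bar> + 1) * \<bar>t\<bar> * \<bar>t\<bar> \<le> e * \<bar>t\<bar>"
      by (rule mult_right_mono) simp
    moreover have "C * t\<^sup>2 \<le> (\<bar>C\<bar> + 1) * \<bar>t\<bar> * \<bar>t\<bar>"
      unfolding mult.assoc power2_eq_square abs_mult_self_eq by (intro mult_right_mono) auto
    ultimately show ?thesis
      using bound[of t] that by (simp add: d_def)
  qed
  ultimately show "\<exists>d>0. \<forall>t. norm (t - 0) < d \<longrightarrow> norm (\<phi> t - \<phi> 0 - (t - 0) *\<^sub>R D) \<le> e * norm (t - 0)"
    by blast
qed

text \<open>The norm is at most the sum of the absolute coordinates, and a summable real family is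
  absolutely summable.\<close>

lemma abs_summable_on_euclidean:
  fixes f :: "'i \<Rightarrow> 'b::euclidean_space"
  assumes "f summable_on A"
  shows "(\<lambda>x. norm (f x)) summable_on A"
proof (rule Infinite_Sum.abs_summable_on_comparison_test')
  have "(\<lambda>x. \<bar>f x \<bullet> b\<bar>) summable_on A" for b
    using summable_on_iff_abs_summable_on_real[THEN iffD1, OF summable_on_bounded_linear[OF bounded_linear_inner_left assms]]
    by simp
  then show "(\<lambda>x. \<Sum>b\<in>Basis. \<bar>f x \<bullet> b\<bar>) summable_on A"
    by (induction rule: finite_induct[OF finite_Basis]) (auto intro: summable_on_add)
qed (rule norm_le_l1)

definition monomial :: "'a::euclidean_space \<Rightarrow> ('a \<Rightarrow> nat) \<Rightarrow> real" where
  "monomial h \<alpha> = (\<Prod>b\<in>Basis. (h \<bullet> b) ^ \<alpha> b)"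

text \<open>The partial derivative of \<open>monomial\<close> at \<open>h\<close> along
  \<open>b\<close>. Where \<open>\<alpha> b = 0\<close>, the truncated exponent is harmless since
  the leading factor is 0.\<close>

definition monomial_deriv :: "'a::euclidean_space \<Rightarrow> 'a \<Rightarrow> ('a \<Rightarrow> nat) \<Rightarrow> real" where
  "monomial_deriv b h \<alpha> = real (\<alpha> b) * (h \<bullet> b) ^ (\<alpha> b - 1) * (\<Prod>c\<in>Basis - {b}. (h \<bullet> c) ^ \<alpha> c)"

definition degree_sum :: "('a::euclidean_space \<Rightarrow> nat) \<Rightarrow> nat" where
  "degree_sum \<alpha> = (\<Sum>b\<in>Basis. \<alpha> b)"

definition has_power_series ::
    "('a::euclidean_space \<Rightarrow> 'b::euclidean_space) \<Rightarrow> 'a \<Rightarrow> real \<Rightarrow> (('a \<Rightarrow> nat) \<Rightarrow> 'b) \<Rightarrow> bool" where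
  "has_power_series f p r a \<longleftrightarrow>
     (\<forall>x\<in>ball p r. ((\<lambda>\<alpha>. monomial (x - p) \<alpha> *\<^sub>R a \<alpha>) has_sum f x) multi_indices)"

text \<open>The coefficients of the series differentiated term by term along
  \<open>b\<close>.\<close>

definition deriv_coeff :: "'a \<Rightarrow> (('a \<Rightarrow> nat) \<Rightarrow> 'b) \<Rightarrow> ('a \<Rightarrow> nat) \<Rightarrow> 'b::real_vector" where
  "deriv_coeff b a \<alpha> = real (Suc (\<alpha> b)) *\<^sub>R a (\<alpha>(b := Suc (\<alpha> b)))"

definition dir_deriv :: "'a::real_vector \<Rightarrow> ('a \<Rightarrow> 'b::real_normed_vector) \<Rightarrow> 'a \<Rightarrow> 'b" where
  "dir_deriv v f x = vector_derivative (\<lambda>t. f (x + t *\<^sub>R v)) (at 0)"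

lemma deriv_coeff_commute: "deriv_coeff b (deriv_coeff c a) = deriv_coeff c (deriv_coeff b a)"
  by (cases "b = c") (auto simp: deriv_coeff_def fun_eq_iff fun_upd_twist mult.commute)

section \<open>Monomials and absolute convergence\<close>

lemma monomial_split:
  assumes "b \<in> Basis"
  shows "monomial h \<alpha> = (h \<bullet> b) ^ \<alpha> b * (\<Prod>c\<in>Basis - {b}. (h \<bullet> c) ^ \<alpha> c)"
  unfolding monomial_def using assms by (simp add: prod.remove)

lemma power_degree_sum_split:
  fixes \<rho> :: real
  assumes "b \<in> Basis"
  shows "\<rho> ^ degree_sum \<alpha> = \<rho> ^ \<alpha> b * (\<Prod>c\<in>Basis - {b}. \<rho> ^ \<alpha> c)"
  unfolding degree_sum_def using assms by (simp add: power_sum prod.remove)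

lemma monomial_One: "monomial (s *\<^sub>R One) \<alpha> = s ^ degree_sum \<alpha>"
  unfolding monomial_def degree_sum_def power_sum
  by (rule prod.cong) (auto simp: inner_sum_left_Basis)

text \<open>At the diagonal point \<open>p + s *\<^sub>R One\<close> every coordinate of the
  increment is \<open>s\<close>, so each monomial equals \<open>s ^ degree_sum \<alpha>\<close>.
  Absolute convergence at this single point gives a majorant that depends only on the total
  degree.\<close>

lemma has_power_series_abs_summable:
  fixes f :: "'a::euclidean_space \<Rightarrow> 'b::euclidean_space"
  assumes "has_power_series f p r a" "r > 0"
  obtains s where "s > 0" "s \<le> r" "(\<lambda>\<alpha>. s ^ degree_sum \<alpha> * norm (a \<alpha>)) summable_on multi_indices"
proof
  \<comment> \<open>Since \<open>norm One\<close> is at most the dimension, the diagonal point lies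
    within r/2 of \<open>p\<close>.\<close>
  define s where "s = r / (2 * real DIM('a))"
  have D: "real DIM('a) \<ge> 1"
    by (simp add: Suc_leI)
  then show "s > 0"
    unfolding s_def using \<open>r > 0\<close> by simp
  have sD: "s * real DIM('a) = r / 2"
    unfolding s_def using D by simp
  have "s * 1 \<le> s * real DIM('a)"
    using D \<open>s > 0\<close> by (intro mult_left_mono) auto
  then show "s \<le> r"
    using sD \<open>r > 0\<close> by simp
  have "norm (One::'a) \<le> real DIM('a)"
    by (rule order_trans[OF norm_sum]) simp
  then have "norm (s *\<^sub>R One :: 'a) \<le> s * real DIM('a)"
    using \<open>s > 0\<close> by simp
  then have "p + s *\<^sub>R One \<in> ball p r"
    using sD \<open>r > 0\<close> by (simp add: dist_norm)
  with assms(1) have "((\<lambda>\<alpha>. s ^ degree_sum \<alpha> *\<^sub>R a \<alpha>) has_sum f (p + s *\<^sub>R One)) multi_indices"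
    unfolding has_power_series_def by (auto dest!: bspec simp only: add_diff_cancel_left' monomial_One)
  then have "(\<lambda>\<alpha>. norm (s ^ degree_sum \<alpha> *\<^sub>R a \<alpha>)) summable_on multi_indices"
    by (intro abs_summable_on_euclidean) (rule has_sum_imp_summable)
  then show "(\<lambda>\<alpha>. s ^ degree_sum \<alpha> * norm (a \<alpha>)) summable_on multi_indices"
    using \<open>s > 0\<close> by simp
qed

section \<open>Bounds for derivatives and Taylor remainders of monomials\<close>

lemma power_taylor2_bound:
  fixes u t \<rho> :: real
  assumes "\<bar>u\<bar> \<le> \<rho>" "\<bar>u + t\<bar> \<le> \<rho>"
  shows "\<bar>(u + t) ^ n - u ^ n - t * (real n * u ^ (n - 1))\<bar> \<le> t\<^sup>2 * (real n * real (n - 1) * \<rho> ^ (n - 2))"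
proof (cases "t = 0")
  case False
  \<comment> \<open>Factoring out \<open>t\<close> leaves the error of a difference quotient, which
    \<open>lemma_termdiff3\<close> bounds by a multiple of \<open>\<bar>t\<bar>\<close>.\<close>
  have "(u + t) ^ n - u ^ n - t * (real n * u ^ (n - 1))
      = t * (((u + t) ^ n - u ^ n) / t - real n * u ^ (n - 1))"
    using False by (simp add: field_simps)
  moreover have "\<bar>t\<bar> * \<bar>((u + t) ^ n - u ^ n) / t - real n * u ^ (n - 1)\<bar>
      \<le> \<bar>t\<bar> * (real n * real (n - 1) * \<rho> ^ (n - 2) * \<bar>t\<bar>)"
    using lemma_termdiff3[of t u \<rho> n] False assms by (intro mult_left_mono) auto
  moreover have "t\<^sup>2 = \<bar>t\<bar> * \<bar>t\<bar>"
    by (simp add: power2_eq_square)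
  ultimately show ?thesis
    by (simp only: abs_mult mult_ac)
qed simp

lemma prod_power_bound:
  fixes h :: "'a::euclidean_space"
  assumes "\<And>c. c \<in> Basis \<Longrightarrow> \<bar>h \<bullet> c\<bar> \<le> \<rho>"
  shows "\<bar>\<Prod>c\<in>Basis - {b}. (h \<bullet> c) ^ \<alpha> c\<bar> \<le> (\<Prod>c\<in>Basis - {b}. \<rho> ^ \<alpha> c)"
  unfolding abs_prod by (rule prod_mono) (auto simp: power_abs intro!: power_mono assms)

text \<open>Both follow from n <= 2^n. The polynomial factors created by differentiation become
  geometric ones, which a smaller radius absorbs.\<close>

lemma nat_le_four_power: "real n \<le> 4 ^ n" "real n * real (n - 1) \<le> 4 ^ n"
proof -
  have *: "real n \<le> 2 ^ n" for n
    using less_exp[of n] by (metis less_imp_le of_nat_le_iff of_nat_numeral of_nat_power)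
  have "(2::real) ^ n \<le> 4 ^ n"
    by (rule power_mono) auto
  with *[of n] show "real n \<le> 4 ^ n"
    by linarith
  have "real (n - 1) \<le> real n"
    by simp
  with *[of n] have "real (n - 1) \<le> 2 ^ n"
    by linarith
  then have "real n * real (n - 1) \<le> 2 ^ n * 2 ^ n"
    by (intro mult_mono *) auto
  also have "\<dots> = (4::real) ^ n"
    by (simp flip: power_mult_distrib)
  finally show "real n * real (n - 1) \<le> 4 ^ n" .
qed

lemma four_power_le: "(4::real) ^ \<alpha> b \<le> 4 ^ degree_sum \<alpha>" if "b \<in> Basis"
  unfolding degree_sum_def using that by (intro power_increasing member_le_sum) auto

text \<open>Differentiation costs one power of \<open>\<rho>\<close> and the factor
  \<open>\<alpha> b\<close>, which is at most \<open>4 ^ degree_sum \<alpha>\<close>.\<close>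

lemma monomial_deriv_bound:
  fixes h :: "'a::euclidean_space"
  assumes "b \<in> Basis" "\<rho> > 0" "\<And>c. c \<in> Basis \<Longrightarrow> \<bar>h \<bullet> c\<bar> \<le> \<rho>"
  shows "\<bar>monomial_deriv b h \<alpha>\<bar> \<le> (4 * \<rho>) ^ degree_sum \<alpha> / \<rho>"
proof -
  define n where "n = \<alpha> b"
  have "\<bar>monomial_deriv b h \<alpha>\<bar> \<le> real n * \<rho> ^ (n - 1) * (\<Prod>c\<in>Basis - {b}. \<rho> ^ \<alpha> c)"
    unfolding monomial_deriv_def abs_mult n_def
    by (intro mult_mono prod_power_bound) (auto simp: power_abs assms less_imp_le prod_nonneg intro!: power_mono)
  also have "\<dots> = real n * \<rho> ^ degree_sum \<alpha> / \<rho>"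
    using assms(2) unfolding power_degree_sum_split[OF assms(1)] n_def[symmetric]
    by (cases n) auto
  also have "\<dots> \<le> 4 ^ degree_sum \<alpha> * \<rho> ^ degree_sum \<alpha> / \<rho>"
    using order_trans[OF nat_le_four_power(1) four_power_le[OF assms(1), of \<alpha>]] assms(2) unfolding n_def
    by (intro divide_right_mono mult_right_mono) (auto simp del: of_nat_le_numeral_power_cancel_iff)
  finally show ?thesis
    by (simp add: power_mult_distrib)
qed

text \<open>Only the factor belonging to \<open>b\<close> varies with \<open>t\<close>, so the
  one-variable remainder bound is multiplied by the bounds of the other factors.\<close>

lemma monomial_taylor2_bound:
  fixes h :: "'a::euclidean_space"
  assumes b: "b \<in> Basis" and "\<rho> > 0" and h: "\<And>c. c \<in> Basis \<Longrightarrow> \<bar>h \<bullet> c\<bar> \<le> \<rho>" and t: "\<bar>h \<bullet> b + t\<bar> \<le> \<rho>"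
  shows "\<bar>monomial (h + t *\<^sub>R b) \<alpha> - monomial h \<alpha> - t * monomial_deriv b h \<alpha>\<bar>
    \<le> t\<^sup>2 / \<rho>\<^sup>2 * (4 * \<rho>) ^ degree_sum \<alpha>"
proof -
  define n where "n = \<alpha> b"
  define P where "P = (\<Prod>c\<in>Basis - {b}. (h \<bullet> c) ^ \<alpha> c)"
  have P: "(\<Prod>c\<in>Basis - {b}. ((h + t *\<^sub>R b) \<bullet> c) ^ \<alpha> c) = P"
    unfolding P_def using b by (intro prod.cong) (auto simp: inner_add_left inner_Basis)
  have "monomial (h + t *\<^sub>R b) \<alpha> - monomial h \<alpha> - t * monomial_deriv b h \<alpha>
      = ((h \<bullet> b + t) ^ n - (h \<bullet> b) ^ n - t * (real n * (h \<bullet> b) ^ (n - 1))) * P"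
    unfolding monomial_split[OF b] monomial_deriv_def P
    using b by (simp add: P_def n_def inner_add_left algebra_simps)
  then have "\<bar>monomial (h + t *\<^sub>R b) \<alpha> - monomial h \<alpha> - t * monomial_deriv b h \<alpha>\<bar>
      \<le> (t\<^sup>2 * (real n * real (n - 1) * \<rho> ^ (n - 2))) * (\<Prod>c\<in>Basis - {b}. \<rho> ^ \<alpha> c)"
    unfolding P_def abs_mult
    by (simp only: abs_mult)
       (intro mult_mono prod_power_bound power_taylor2_bound; simp add: assms less_imp_le)
  also have "\<dots> = t\<^sup>2 / \<rho>\<^sup>2 * (real n * real (n - 1) * \<rho> ^ degree_sum \<alpha>)"
  proof -
    \<comment> \<open>For n < 2 the exponent is truncated, but then n (n - 1) = 0 on both
      sides.\<close>
    have "real n * real (n - 1) * \<rho> ^ (n - 2) = real n * real (n - 1) * \<rho> ^ n / \<rho>\<^sup>2"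
      using \<open>\<rho> > 0\<close> by (cases "n \<ge> 2") (auto simp: power_diff not_le less_2_cases_iff)
    then show ?thesis
      unfolding power_degree_sum_split[OF b] n_def[symmetric] by simp
  qed
  also have "\<dots> \<le> t\<^sup>2 / \<rho>\<^sup>2 * (4 ^ degree_sum \<alpha> * \<rho> ^ degree_sum \<alpha>)"
    using order_trans[OF nat_le_four_power(2) four_power_le[OF b, of \<alpha>]] \<open>\<rho> > 0\<close> unfolding n_def
    by (intro mult_left_mono mult_right_mono) auto
  finally show ?thesis
    by (simp add: power_mult_distrib)
qed

text \<open>Raising the exponent of \<open>b\<close> by one maps the multi-indices bijectively onto
  those with \<open>\<alpha> b \<noteq> 0\<close>; the remaining indices contribute 0 to the
  differentiated series.\<close>

lemma has_sum_deriv_coeff: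
  fixes h :: "'a::euclidean_space"
  assumes b: "b \<in> Basis"
    and sum: "((\<lambda>\<alpha>. monomial_deriv b h \<alpha> *\<^sub>R a \<alpha>) has_sum D) multi_indices"
  shows "((\<lambda>\<alpha>. monomial h \<alpha> *\<^sub>R deriv_coeff b a \<alpha>) has_sum D) multi_indices"
proof -
  let ?up = "\<lambda>\<alpha>::'a \<Rightarrow> nat. \<alpha>(b := Suc (\<alpha> b))"
  have "bij_betw ?up multi_indices {\<alpha> \<in> multi_indices. \<alpha> b \<noteq> 0}"
    by (rule bij_betw_byWitness[where f' = "\<lambda>\<alpha>. \<alpha>(b := \<alpha> b - 1)"])
       (use b in \<open>auto simp: multi_indices_def\<close>)
  moreover have "((\<lambda>\<alpha>. monomial_deriv b h \<alpha> *\<^sub>R a \<alpha>) has_sum D) {\<alpha> \<in> multi_indices. \<alpha> b \<noteq> 0}"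
    using sum by (subst has_sum_cong_neutral[where T = multi_indices])
                 (auto simp: monomial_deriv_def)
  ultimately have "((\<lambda>\<alpha>. monomial_deriv b h (?up \<alpha>) *\<^sub>R a (?up \<alpha>)) has_sum D) multi_indices"
    by (simp only: has_sum_reindex_bij_betw[of ?up _ _ "\<lambda>\<alpha>. monomial_deriv b h \<alpha> *\<^sub>R a \<alpha>"])
  moreover have "monomial_deriv b h (?up \<alpha>) *\<^sub>R a (?up \<alpha>) = monomial h \<alpha> *\<^sub>R deriv_coeff b a \<alpha>" for \<alpha>
  proof -
    have "(\<Prod>c\<in>Basis - {b}. (h \<bullet> c) ^ ?up \<alpha> c) = (\<Prod>c\<in>Basis - {b}. (h \<bullet> c) ^ \<alpha> c)"
      by (rule prod.cong) auto
    then show ?thesis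
      by (simp add: monomial_deriv_def monomial_split[OF b] deriv_coeff_def mult_ac)
  qed
  ultimately show ?thesis
    by simp
qed

(* The Taylor remainder of each monomial along b is at most t^2 times a term that the absolutely
   convergent series at radius s dominates on the ball of radius s / 4, as n (n - 1) <= 4^n. *)
lemma has_power_series_deriv:
  fixes f :: "'a::euclidean_space \<Rightarrow> 'b::euclidean_space"
  assumes f: "has_power_series f p r a" and "r > 0"
  obtains \<rho> where "\<rho> > 0"
    "\<forall>b\<in>Basis. \<forall>x\<in>ball p \<rho>. ((\<lambda>t. f (x + t *\<^sub>R b)) has_vector_derivative dir_deriv b f x) (at 0)"
    "\<forall>b\<in>Basis. has_power_series (dir_deriv b f) p \<rho> (deriv_coeff b a)"
proof -
  obtain s where s: "s > 0" "s \<le> r"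
    and summable: "(\<lambda>\<alpha>. s ^ degree_sum \<alpha> * norm (a \<alpha>)) summable_on multi_indices"
    using has_power_series_abs_summable[OF assms] by blast
  define \<rho> where "\<rho> = s / 4"
  have \<rho>: "\<rho> > 0" "\<rho> \<le> r" "s = 4 * \<rho>"
    using s by (auto simp: \<rho>_def)
  define C where "C = (\<Sum>\<^sub>\<infinity>\<alpha>\<in>multi_indices. s ^ degree_sum \<alpha> * norm (a \<alpha>))"
  have coord: "\<bar>(x - p) \<bullet> c\<bar> \<le> \<rho>" if "x \<in> ball p \<rho>" "c \<in> Basis" for x c
    using that Basis_le_norm[of c "x - p"] by (simp add: dist_norm norm_minus_commute)
  have key: "\<exists>D. ((\<lambda>t. f (x + t *\<^sub>R b)) has_vector_derivative D) (at 0) \<and>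
      ((\<lambda>\<alpha>. monomial (x - p) \<alpha> *\<^sub>R deriv_coeff b a \<alpha>) has_sum D) multi_indices"
    if b: "b \<in> Basis" and x: "x \<in> ball p \<rho>" for b x
  proof -
    define h where "h = x - p"
    have h: "\<bar>h \<bullet> c\<bar> \<le> \<rho>" if "c \<in> Basis" for c
      unfolding h_def using coord[OF x that] .
    have "(\<lambda>\<alpha>. (1 / \<rho>) * (s ^ degree_sum \<alpha> * norm (a \<alpha>))) summable_on multi_indices"
      by (rule summable_on_cmult_right[OF summable])
    then have "(\<lambda>\<alpha>. norm (monomial_deriv b h \<alpha> *\<^sub>R a \<alpha>)) summable_on multi_indices"
    proof (rule Infinite_Sum.abs_summable_on_comparison_test')
      fix \<alpha>
      show "norm (monomial_deriv b h \<alpha> *\<^sub>R a \<alpha>) \<le> (1 / \<rho>) * (s ^ degree_sum \<alpha> * norm (a \<alpha>))"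
        using mult_right_mono[OF monomial_deriv_bound[OF b \<open>\<rho> > 0\<close> h, of \<alpha>] norm_ge_zero[of "a \<alpha>"]]
        by (simp add: \<rho>(3))
    qed
    then have "(\<lambda>\<alpha>. monomial_deriv b h \<alpha> *\<^sub>R a \<alpha>) summable_on multi_indices"
      by (rule Infinite_Sum.abs_summable_summable)
    then obtain D where D: "((\<lambda>\<alpha>. monomial_deriv b h \<alpha> *\<^sub>R a \<alpha>) has_sum D) multi_indices"
      unfolding summable_on_def ..
    \<comment> \<open>As \<open>b\<close> has norm 1, steps shorter than this stay in the
      ball.\<close>
    define \<delta> where "\<delta> = \<rho> - dist p x"
    have "\<delta> > 0"
      using x by (simp add: \<delta>_def)
    have "((\<lambda>t. f (x + t *\<^sub>R b)) has_vector_derivative D) (at 0)"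
    proof (rule has_vector_derivative_quadratic[OF \<open>\<delta> > 0\<close>])
      fix t :: real assume t: "\<bar>t\<bar> < \<delta>"
      have "dist p (x + t *\<^sub>R b) \<le> dist p x + dist x (x + t *\<^sub>R b)"
        by (rule dist_triangle)
      then have xt: "x + t *\<^sub>R b \<in> ball p \<rho>"
        using t b by (simp add: \<delta>_def dist_norm)
      have ht: "x + t *\<^sub>R b - p = h + t *\<^sub>R b"
        by (simp add: h_def)
      have hbt: "\<bar>h \<bullet> b + t\<bar> \<le> \<rho>"
        using coord[OF xt b] b by (simp add: ht inner_add_left)
      let ?R = "\<lambda>\<alpha>. monomial (h + t *\<^sub>R b) \<alpha> - monomial h \<alpha> - t * monomial_deriv b h \<alpha>"
      have "((\<lambda>\<alpha>. monomial (h + t *\<^sub>R b) \<alpha> *\<^sub>R a \<alpha>) has_sum f (x + t *\<^sub>R b)) multi_indices"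
        "((\<lambda>\<alpha>. monomial h \<alpha> *\<^sub>R a \<alpha>) has_sum f x) multi_indices"
        using f x xt \<rho>(2) unfolding has_power_series_def h_def by (auto dest!: bspec[of _ _ "x + t *\<^sub>R b"] simp: algebra_simps)
      \<comment> \<open>The series at \<open>x + t *\<^sub>R b\<close>, the series at
        \<open>x\<close> and the differentiated series, with coefficients 1, -1 and -t, combine to a
        series of monomial remainders for the remainder of \<open>f\<close>.\<close>
      from has_sum_add[OF has_sum_add[OF this(1) has_sum_scaleR[OF this(2), of "-1"]] has_sum_scaleR[OF D, of "-t"]]
      have R: "((\<lambda>\<alpha>. ?R \<alpha> *\<^sub>R a \<alpha>) has_sum (f (x + t *\<^sub>R b) - f x - t *\<^sub>R D)) multi_indices"
        by (simp add: scaleR_diff_left)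
      have bound: "norm (?R \<alpha> *\<^sub>R a \<alpha>) \<le> t\<^sup>2 / \<rho>\<^sup>2 * (s ^ degree_sum \<alpha> * norm (a \<alpha>))" for \<alpha>
        using mult_right_mono[OF monomial_taylor2_bound[OF b \<open>\<rho> > 0\<close> h hbt, of \<alpha>] norm_ge_zero[of "a \<alpha>"]]
        by (simp add: \<rho>(3) mult.assoc)
      have "((\<lambda>\<alpha>. t\<^sup>2 / \<rho>\<^sup>2 * (s ^ degree_sum \<alpha> * norm (a \<alpha>))) has_sum (t\<^sup>2 / \<rho>\<^sup>2 * C)) multi_indices"
        unfolding C_def by (intro has_sum_cmult_right has_sum_infsum summable)
      from norm_infsum_le[OF R this bound]
      show "norm (f (x + t *\<^sub>R b) - f (x + 0 *\<^sub>R b) - t *\<^sub>R D) \<le> C / \<rho>\<^sup>2 * t\<^sup>2"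
        by (simp add: mult.commute)
    qed
    moreover have "((\<lambda>\<alpha>. monomial (x - p) \<alpha> *\<^sub>R deriv_coeff b a \<alpha>) has_sum D) multi_indices"
      using has_sum_deriv_coeff[OF b D] unfolding h_def .
    ultimately show ?thesis
      by blast
  qed
  have "((\<lambda>t. f (x + t *\<^sub>R b)) has_vector_derivative dir_deriv b f x) (at 0) \<and>
      ((\<lambda>\<alpha>. monomial (x - p) \<alpha> *\<^sub>R deriv_coeff b a \<alpha>) has_sum dir_deriv b f x) multi_indices"
    if "b \<in> Basis" "x \<in> ball p \<rho>" for b x
  proof -
    obtain D where "((\<lambda>t. f (x + t *\<^sub>R b)) has_vector_derivative D) (at 0)"
      "((\<lambda>\<alpha>. monomial (x - p) \<alpha> *\<^sub>R deriv_coeff b a \<alpha>) has_sum D) multi_indices"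
      using key \<open>b \<in> Basis\<close> \<open>x \<in> ball p \<rho>\<close> by blast
    moreover from this(1) have "dir_deriv b f x = D"
      unfolding dir_deriv_def by (rule vector_derivative_at)
    ultimately show ?thesis
      by simp
  qed
  then show ?thesis
    by (intro that[OF \<rho>(1)]) (simp_all add: has_power_series_def)
qed

section \<open>Derivatives of real-analytic functions\<close>

lemma real_analytic_at_iff_has_power_series:
  "real_analytic_at f p \<longleftrightarrow> (\<exists>r>0. \<exists>a. has_power_series f p r a)"
  unfolding real_analytic_at_def has_power_series_def monomial_def ..

lemma real_analytic_at_dir_deriv:
  assumes "real_analytic_at f p" "b \<in> Basis"
  shows "((\<lambda>t. f (p + t *\<^sub>R b)) has_vector_derivative dir_deriv b f p) (at 0)"
    and "real_analytic_at (dir_deriv b f) p"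
proof -
  obtain r a where r: "r > 0" and a: "has_power_series f p r a"
    using assms(1) unfolding real_analytic_at_iff_has_power_series by blast
  obtain \<rho> where "\<rho> > 0"
    "\<forall>b\<in>Basis. \<forall>x\<in>ball p \<rho>. ((\<lambda>t. f (x + t *\<^sub>R b)) has_vector_derivative dir_deriv b f x) (at 0)"
    "\<forall>b\<in>Basis. has_power_series (dir_deriv b f) p \<rho> (deriv_coeff b a)"
    by (rule has_power_series_deriv[OF a r])
  with assms(2) show "((\<lambda>t. f (p + t *\<^sub>R b)) has_vector_derivative dir_deriv b f p) (at 0)"
    "real_analytic_at (dir_deriv b f) p"
    unfolding real_analytic_at_iff_has_power_series by (simp, blast)
qed

text \<open>Both mixed derivatives are sums of one series at the centre, because the two coefficient
  shifts commute; sums are unique.\<close>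

lemma dir_deriv_commute:
  assumes "real_analytic_at f p" "b \<in> Basis" "c \<in> Basis"
  shows "dir_deriv b (dir_deriv c f) p = dir_deriv c (dir_deriv b f) p"
proof -
  obtain r a where r: "r > 0" and a: "has_power_series f p r a"
    using assms(1) unfolding real_analytic_at_iff_has_power_series by blast
  obtain \<rho> where \<rho>: "\<rho> > 0"
    and pow: "\<forall>b\<in>Basis. has_power_series (dir_deriv b f) p \<rho> (deriv_coeff b a)"
    by (rule has_power_series_deriv[OF a r])
  have "((\<lambda>\<alpha>. monomial 0 \<alpha> *\<^sub>R deriv_coeff v (deriv_coeff u a) \<alpha>) has_sum dir_deriv v (dir_deriv u f) p)
      multi_indices" if "u \<in> Basis" "v \<in> Basis" for u v
  proof -
    \<comment> \<open>The second differentiation shrinks the radius again, which does no harm since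
      the series is evaluated at \<open>p\<close> only.\<close>
    obtain \<sigma> where "\<sigma> > 0"
      "\<forall>v\<in>Basis. has_power_series (dir_deriv v (dir_deriv u f)) p \<sigma> (deriv_coeff v (deriv_coeff u a))"
      by (rule has_power_series_deriv[OF bspec[OF pow \<open>u \<in> Basis\<close>] \<rho>])
    then show ?thesis
      using \<open>v \<in> Basis\<close> unfolding has_power_series_def by (force dest: bspec[of Basis _ v] bspec[of "ball p \<sigma>" _ p])
  qed
  from this[OF assms(3,2)] this[OF assms(2,3)] show ?thesis
    unfolding deriv_coeff_commute[of b c a] by (rule has_sum_unique)
qed

text \<open>\<open>L\<close> passes through the sum to the coefficients. With \<open>L\<close> a
  coordinate projection this gives analyticity of the components of \<open>g\<close>.\<close>

lemma real_analytic_at_bounded_linear: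
  assumes "real_analytic_at f p" "bounded_linear L"
  shows "real_analytic_at (\<lambda>x. L (f x)) p"
proof -
  interpret L: bounded_linear L by fact
  obtain r a where "r > 0" "has_power_series f p r a"
    using assms(1) unfolding real_analytic_at_iff_has_power_series by blast
  then have "has_power_series (\<lambda>x. L (f x)) p r (\<lambda>\<alpha>. L (a \<alpha>))"
    unfolding has_power_series_def
    by (auto dest!: has_sum_bounded_linear[OF assms(2)] bspec simp: L.scaleR)
  with \<open>r > 0\<close> show ?thesis
    unfolding real_analytic_at_iff_has_power_series by blast
qed

section \<open>Augmented Wirtinger derivatives\<close>

text \<open>The involution of the slots whose permutation matrix is \<open>swap_mat\<close>.\<close>

definition conj_index :: "'n + 'n \<Rightarrow> 'n + 'n" where
  "conj_index l = (case l of Inl k \<Rightarrow> Inr k | Inr k \<Rightarrow> Inl k)"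

lemma conj_index_simps [simp]:
  "conj_index (Inl k) = Inr k" "conj_index (Inr k) = Inl k" "conj_index (conj_index l) = l"
  by (auto simp: conj_index_def split: sum.split)

lemma sum_conj_index: "(\<Sum>l\<in>UNIV. f (conj_index l)) = (\<Sum>l\<in>UNIV. f l)"
  by (rule sum.reindex_bij_witness[of _ conj_index conj_index]) auto

text \<open>The slots of z_k and of its conjugate share both real directions, so conjugating a slot
  affects only \<open>wirtinger_unit\<close>.\<close>

definition re_dir :: "'n + 'n \<Rightarrow> complex ^ 'n" where
  "re_dir l = (case l of Inl k \<Rightarrow> axis k 1 | Inr k \<Rightarrow> axis k 1)"

definition im_dir :: "'n + 'n \<Rightarrow> complex ^ 'n" where
  "im_dir l = (case l of Inl k \<Rightarrow> axis k \<i> | Inr k \<Rightarrow> axis k \<i>)"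

(* The coefficient of the y-derivative in the Wirtinger operator of slot l. *)
definition wirtinger_unit :: "'n + 'n \<Rightarrow> complex" where
  "wirtinger_unit l = (case l of Inl k \<Rightarrow> - \<i> | Inr k \<Rightarrow> \<i>)"

lemma re_dir_in_Basis: "re_dir l \<in> Basis"
  and im_dir_in_Basis: "im_dir l \<in> Basis"
  by (auto simp: re_dir_def im_dir_def Basis_complex_def split: sum.split)

lemma conj_index_dirs [simp]:
  "re_dir (conj_index l) = re_dir l" "im_dir (conj_index l) = im_dir l"
  "wirtinger_unit (conj_index l) = cnj (wirtinger_unit l)"
  by (auto simp: re_dir_def im_dir_def wirtinger_unit_def conj_index_def split: sum.split)

lemma aug_partial_eq:
  "aug_partial l f z = (1/2) * (dir_deriv (re_dir l) f z + wirtinger_unit l * dir_deriv (im_dir l) f z)"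
proof -
  have "axis k (complex_of_real t) = t *\<^sub>R axis k 1" "axis k (\<i> * complex_of_real t) = t *\<^sub>R axis k \<i>"
    for k :: 'a and t
    by (auto simp: vec_eq_iff axis_def complex_eq_iff)
  then show ?thesis
    by (auto simp: aug_partial_def wirtinger_def wirtinger_bar_def partial_x_def partial_y_def
        dir_deriv_def re_dir_def im_dir_def wirtinger_unit_def split: sum.split)
qed

text \<open>\<open>aug_partial\<close> has some value even where a line derivative fails to exist.
  This relation also asserts existence, so the rules of calculus compose without separate
  differentiability conditions.\<close>

definition has_aug_partial ::
    "'n + 'n \<Rightarrow> (complex ^ 'n \<Rightarrow> complex) \<Rightarrow> complex \<Rightarrow> complex ^ 'n \<Rightarrow> bool" where
  "has_aug_partial l f D z \<longleftrightarrow>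
     (\<exists>X Y. ((\<lambda>t. f (z + t *\<^sub>R re_dir l)) has_vector_derivative X) (at 0) \<and>
            ((\<lambda>t. f (z + t *\<^sub>R im_dir l)) has_vector_derivative Y) (at 0) \<and>
            D = (1/2) * (X + wirtinger_unit l * Y))"

lemma has_aug_partialE:
  assumes "has_aug_partial l f D z"
  obtains X Y where "((\<lambda>t. f (z + t *\<^sub>R re_dir l)) has_vector_derivative X) (at 0)"
    "((\<lambda>t. f (z + t *\<^sub>R im_dir l)) has_vector_derivative Y) (at 0)"
    "D = (1/2) * (X + wirtinger_unit l * Y)"
  using assms unfolding has_aug_partial_def by blast

lemma has_aug_partialI:
  assumes "((\<lambda>t. f (z + t *\<^sub>R re_dir l)) has_vector_derivative X) (at 0)"
    "((\<lambda>t. f (z + t *\<^sub>R im_dir l)) has_vector_derivative Y) (at 0)"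
    "D = (1/2) * (X + wirtinger_unit l * Y)"
  shows "has_aug_partial l f D z"
  using assms unfolding has_aug_partial_def by blast

lemma has_aug_partial_imp_eq: "has_aug_partial l f D z \<Longrightarrow> aug_partial l f z = D"
  by (elim has_aug_partialE) (simp add: aug_partial_eq dir_deriv_def vector_derivative_at)

lemma has_aug_partial_works: "has_aug_partial l f D z \<Longrightarrow> has_aug_partial l f (aug_partial l f z) z"
  by (simp only: has_aug_partial_imp_eq)

section \<open>Rules of calculus for the augmented operators\<close>

lemma has_aug_partial_const: "has_aug_partial l (\<lambda>w. c) 0 z"
  by (rule has_aug_partialI[where X = 0 and Y = 0]) auto

lemma has_aug_partial_add:
  assumes "has_aug_partial l f D z" "has_aug_partial l g E z"
  shows "has_aug_partial l (\<lambda>w. f w + g w) (D + E) z"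
  using assms
  by (elim has_aug_partialE) (rule has_aug_partialI, (rule has_vector_derivative_add, assumption+)+, simp add: algebra_simps)

lemma has_aug_partial_mult:
  assumes "has_aug_partial l f D z" "has_aug_partial l g E z"
  shows "has_aug_partial l (\<lambda>w. f w * g w) (f z * E + D * g z) z"
  using assms
  by (elim has_aug_partialE) (rule has_aug_partialI, (rule has_vector_derivative_mult, assumption+)+, simp add: algebra_simps)

lemma has_aug_partial_cmult:
  assumes "has_aug_partial l f D z"
  shows "has_aug_partial l (\<lambda>w. c * f w) (c * D) z"
  using has_aug_partial_mult[OF has_aug_partial_const assms, of c] by simp

lemma has_aug_partial_const_diff:
  assumes "has_aug_partial l f D z"
  shows "has_aug_partial l (\<lambda>w. c - f w) (- D) z"
  using has_aug_partial_add[OF has_aug_partial_const has_aug_partial_cmult[OF assms, of "-1"], of c]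
  by simp

lemma has_aug_partial_minus:
  assumes "has_aug_partial l f D z"
  shows "has_aug_partial l (\<lambda>w. - f w) (- D) z"
  using has_aug_partial_const_diff[OF assms, of 0] by simp

lemma has_aug_partial_sum:
  assumes "finite I" "\<And>i. i \<in> I \<Longrightarrow> has_aug_partial l (f i) (D i) z"
  shows "has_aug_partial l (\<lambda>w. \<Sum>i\<in>I. f i w) (\<Sum>i\<in>I. D i) z"
  using assms by (induction I) (auto intro: has_aug_partial_const has_aug_partial_add)

text \<open>Conjugation commutes with derivatives along real lines; it only conjugates the unit, and
  the conjugate unit belongs to the other slot.\<close>

lemma has_aug_partial_cnj:
  assumes "has_aug_partial (conj_index l) f D z"
  shows "has_aug_partial l (\<lambda>w. cnj (f w)) (cnj D) z"
proof -
  obtain X Y where "((\<lambda>t. f (z + t *\<^sub>R re_dir l)) has_vector_derivative X) (at 0)"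
    "((\<lambda>t. f (z + t *\<^sub>R im_dir l)) has_vector_derivative Y) (at 0)"
    and D: "D = (1/2) * (X + cnj (wirtinger_unit l) * Y)"
    using assms by (rule has_aug_partialE) simp
  from this(1,2)[THEN has_vector_derivative_cnj] show ?thesis
    by (rule has_aug_partialI) (simp add: D)
qed

lemmas has_aug_partial_intros =
  has_aug_partial_cmult has_aug_partial_const_diff has_aug_partial_minus has_aug_partial_cnj

section \<open>Second derivatives of analytic functions\<close>

lemma has_aug_partial_analytic:
  assumes "real_analytic_at f z"
  shows "has_aug_partial l f (aug_partial l f z) z"
  using real_analytic_at_dir_deriv(1)[OF assms re_dir_in_Basis, of l]
    real_analytic_at_dir_deriv(1)[OF assms im_dir_in_Basis, of l] aug_partial_eq
  by (rule has_aug_partialI)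

text \<open>\<open>aug_partial l f\<close> is a constant combination of two directional derivatives,
  each again analytic at \<open>z\<close>.\<close>

lemma has_aug_partial_aug_partial:
  assumes "real_analytic_at f z"
  shows "has_aug_partial m (aug_partial l f) (aug_partial m (aug_partial l f) z) z"
    and "aug_partial m (aug_partial l f) z
       = (1/2) * (aug_partial m (dir_deriv (re_dir l) f) z
           + wirtinger_unit l * aug_partial m (dir_deriv (im_dir l) f) z)"
proof -
  have "has_aug_partial m (\<lambda>w. (1/2) * (dir_deriv (re_dir l) f w + wirtinger_unit l * dir_deriv (im_dir l) f w))
      ((1/2) * (aug_partial m (dir_deriv (re_dir l) f) z
           + wirtinger_unit l * aug_partial m (dir_deriv (im_dir l) f) z)) z"
    by (intro has_aug_partial_cmult has_aug_partial_add has_aug_partial_analytic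
        real_analytic_at_dir_deriv(2)[OF assms] re_dir_in_Basis im_dir_in_Basis)
  then have *: "has_aug_partial m (aug_partial l f) ((1/2) * (aug_partial m (dir_deriv (re_dir l) f) z
           + wirtinger_unit l * aug_partial m (dir_deriv (im_dir l) f) z)) z"
    by (simp only: aug_partial_eq[of l f, symmetric])
  then show "aug_partial m (aug_partial l f) z
       = (1/2) * (aug_partial m (dir_deriv (re_dir l) f) z
           + wirtinger_unit l * aug_partial m (dir_deriv (im_dir l) f) z)"
    by (rule has_aug_partial_imp_eq)
  show "has_aug_partial m (aug_partial l f) (aug_partial m (aug_partial l f) z) z"
    using * by (rule has_aug_partial_works)
qed

lemma aug_partial_commute:
  assumes "real_analytic_at f z"
  shows "aug_partial m (aug_partial l f) z = aug_partial l (aug_partial m f) z"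
  unfolding has_aug_partial_aug_partial(2)[OF assms]
  unfolding aug_partial_eq
  using dir_deriv_commute[OF assms re_dir_in_Basis[of m] re_dir_in_Basis[of l]]
    dir_deriv_commute[OF assms re_dir_in_Basis[of m] im_dir_in_Basis[of l]]
    dir_deriv_commute[OF assms im_dir_in_Basis[of m] re_dir_in_Basis[of l]]
    dir_deriv_commute[OF assms im_dir_in_Basis[of m] im_dir_in_Basis[of l]]
  by (simp add: algebra_simps)

lemma aug_hessian_nth: "aug_hessian f z $ k $ l = aug_partial l (\<lambda>w. cnj (aug_partial k f w)) z"
  by (simp add: aug_hessian_def aug_jacobian_def vec_cnj_def aug_gradient_def)

text \<open>Pulling the conjugation out of the outer operator turns slot \<open>l\<close> into its
  conjugate.\<close>

lemma aug_hessian_analytic_nth: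
  assumes "real_analytic_at f z"
  shows "aug_hessian f z $ k $ l = cnj (aug_partial (conj_index l) (aug_partial k f) z)"
  unfolding aug_hessian_nth
  by (intro has_aug_partial_imp_eq has_aug_partial_cnj has_aug_partial_aug_partial(1) assms)

section \<open>The projection P and the Hessian of the loss\<close>

lemma swap_mat_nth: "swap_mat $ k $ l = (if l = conj_index k then 1 else 0)"
  by (cases k; cases l) (auto simp: swap_mat_def)

text \<open>Multiplication by \<open>swap_mat\<close> permutes rows from the left and columns from
  the right, each by \<open>conj_index\<close>.\<close>

lemma proj_P_nth: "proj_P M $ k $ l = (1/2) * (M $ k $ l + cnj (M $ conj_index k $ conj_index l))"
proof -
  have "(swap_mat ** A) $ k $ l = A $ conj_index k $ l" for A :: "complex ^ ('a + 'a) ^ ('a + 'a)" and k l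
    by (simp add: matrix_matrix_mult_def swap_mat_nth if_distrib[of "\<lambda>x. x * _"] cong: if_cong)
  moreover have "(A ** swap_mat) $ k $ l = A $ k $ conj_index l" for A :: "complex ^ ('a + 'a) ^ ('a + 'a)" and k l
  proof -
    have "(l = conj_index m) = (m = conj_index l)" for m
      by (metis conj_index_simps(3))
    then show ?thesis
      by (simp add: matrix_matrix_mult_def swap_mat_nth if_distrib[of "\<lambda>x. _ * x"] cong: if_cong)
  qed
  ultimately show ?thesis
    by (simp add: proj_P_def mat_scale_def mat_cnj_def)
qed

text \<open>The space is the fixed-point set of the conjugate-linear involution v -> S (cnj
  v).\<close>

lemma aug_space_iff: "v \<in> aug_space \<longleftrightarrow> (\<forall>k. v $ conj_index k = cnj (v $ k))"
proof
  assume "v \<in> aug_space"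
  then show "\<forall>k. v $ conj_index k = cnj (v $ k)"
    by (auto simp: aug_space_def aug_vec_def conj_index_def split: sum.split)
next
  assume *: "\<forall>k. v $ conj_index k = cnj (v $ k)"
  have "v = aug_vec (\<chi> i. v $ Inl i)"
    using *[rule_format, of "Inl _"] by (simp add: aug_vec_def vec_eq_iff split: sum.split)
  then show "v \<in> aug_space"
    unfolding aug_space_def by blast
qed

text \<open>P(M) is unchanged under M -> S (cnj M) S, hence commutes with the involution that fixes
  \<open>aug_space\<close> pointwise. In coordinates this is a reindexing of the sum by
  \<open>conj_index\<close>.\<close>

lemma proj_P_mult_aug_space:
  assumes "v \<in> aug_space"
  shows "proj_P M *v v \<in> aug_space"
  unfolding aug_space_iff
proof
  fix k
  have P: "proj_P M $ conj_index k $ l = cnj (proj_P M $ k $ conj_index l)" for l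
    by (simp add: proj_P_nth add.commute)
  have v: "v $ l = cnj (v $ conj_index l)" for l
    using assms by (simp add: aug_space_iff)
  have "(proj_P M *v v) $ conj_index k = (\<Sum>l\<in>UNIV. cnj (proj_P M $ k $ conj_index l * v $ conj_index l))"
    unfolding matrix_vector_mult_def by (simp add: P v[symmetric])
  also have "\<dots> = cnj ((proj_P M *v v) $ k)"
    unfolding sum_conj_index[of "\<lambda>l. cnj (proj_P M $ k $ l * v $ l)"] by (simp add: matrix_vector_mult_def)
  finally show "(proj_P M *v v) $ conj_index k = cnj ((proj_P M *v v) $ k)" .
qed

section \<open>Residual Hessians\<close>

lemma residual_hessian_nth:
  assumes "real_analytic_at (\<lambda>w. g w $ i) z"
  shows "residual_hessian W y g i z $ k $ l = (1/2) *
     ((W *v residual y g z) $ i * cnj (aug_partial (conj_index l) (aug_partial k (\<lambda>w. g w $ i)) z)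
       + cnj ((W *v residual y g z) $ i) * aug_partial l (aug_partial (conj_index k) (\<lambda>w. g w $ i)) z)"
  by (simp add: residual_hessian_def proj_P_nth mat_scale_def aug_hessian_analytic_nth[OF assms])

text \<open>Conjugate transposition exchanges the two summands of an entry, up to the order of the
  two derivatives, which commute.\<close>

lemma residual_hessian_hermitian:
  assumes "real_analytic_at (\<lambda>w. g w $ i) z"
  shows "hermitian (residual_hessian W y g i z)"
  by (simp add: hermitian_def vec_eq_iff ctranspose_def transpose_def mat_cnj_def
      residual_hessian_nth[OF assms] aug_partial_commute[OF assms, of "conj_index _"] add.commute)

section \<open>Hermitian forms and derivatives of the loss\<close>

lemma hermitian_nth: "hermitian A \<Longrightarrow> cnj (A $ i $ j) = A $ j $ i"
  unfolding hermitian_def ctranspose_def transpose_def mat_cnj_def vec_eq_iff by simp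

text \<open>This is u^H W x = (W u)^H x. It is stated with sums so that it applies directly to the
  terms the product rule produces.\<close>

lemma sum_hermitian_swap:
  assumes "hermitian W"
  shows "(\<Sum>i\<in>UNIV. cnj (u $ i) * (\<Sum>j\<in>UNIV. W $ i $ j * x j)) = (\<Sum>i\<in>UNIV. cnj ((W *v u) $ i) * x i)"
proof -
  have "(\<Sum>i\<in>UNIV. cnj (u $ i) * (\<Sum>j\<in>UNIV. W $ i $ j * x j))
      = (\<Sum>j\<in>UNIV. \<Sum>i\<in>UNIV. cnj (u $ i) * (W $ i $ j * x j))"
    by (subst sum.swap) (simp add: sum_distrib_left)
  also have "\<dots> = (\<Sum>j\<in>UNIV. cnj ((W *v u) $ j) * x j)"
    by (simp add: matrix_vector_mult_def sum_distrib_right sum_distrib_left hermitian_nth[OF assms] mult_ac)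
  finally show ?thesis .
qed

lemma cnj_lsq_loss:
  assumes "hermitian W"
  shows "cnj (lsq_loss W y g z) = lsq_loss W y g z"
proof -
  have "sesq W u = (\<Sum>i\<in>UNIV. cnj ((W *v u) $ i) * u $ i)" for u
    unfolding sesq_def using sum_hermitian_swap[OF assms, of u "($) u"]
    by (simp add: matrix_vector_mult_def)
  then have "cnj (sesq W u) = sesq W u" for u
    by (simp add: sesq_def mult.commute)
  then show ?thesis
    by (simp add: lsq_loss_def)
qed

text \<open>The product rule for cnj e_i times (W e)_i. The value keeps the shape in which the rules
  deliver it, so that it can be differentiated again.\<close>

lemma has_aug_partial_lsq_loss:
  assumes "\<And>i. real_analytic_at (\<lambda>w. g w $ i) z"
  shows "has_aug_partial l (lsq_loss W y g)
    ((1/2) * (\<Sum>i\<in>UNIV. cnj (y $ i - g z $ i) * (\<Sum>j\<in>UNIV. W $ i $ j * - aug_partial l (\<lambda>w. g w $ j) z)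
       + cnj (- aug_partial (conj_index l) (\<lambda>w. g w $ i) z) * (\<Sum>j\<in>UNIV. W $ i $ j * (y $ j - g z $ j)))) z"
proof -
  have "lsq_loss W y g = (\<lambda>w. (1/2) * (\<Sum>i\<in>UNIV. cnj (y $ i - g w $ i) * (\<Sum>j\<in>UNIV. W $ i $ j * (y $ j - g w $ j))))"
    by (simp add: fun_eq_iff lsq_loss_def sesq_def residual_def matrix_vector_mult_def)
  then show ?thesis
    by (simp only:)
      (intro has_aug_partial_mult has_aug_partial_intros has_aug_partial_sum has_aug_partial_analytic finite assms)
qed

text \<open>For a real loss the conjugated gradient entry of slot k is the gradient entry of slot
  k'. Differentiating its two sums by the product rule gives four.\<close>

lemma aug_hessian_lsq_loss_nth:
  assumes g: "\<And>w i. real_analytic_at (\<lambda>w. g w $ i) w" and W: "hermitian W"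
  shows "aug_hessian (lsq_loss W y g) z $ k $ l = (1/2) * (\<Sum>i\<in>UNIV.
      (cnj (y $ i - g z $ i) * (\<Sum>j\<in>UNIV. W $ i $ j * - aug_partial l (aug_partial (conj_index k) (\<lambda>w. g w $ j)) z)
       + cnj (- aug_partial (conj_index l) (\<lambda>w. g w $ i) z) * (\<Sum>j\<in>UNIV. W $ i $ j * - aug_partial (conj_index k) (\<lambda>w. g w $ j) z))
      + (cnj (- aug_partial k (\<lambda>w. g w $ i) z) * (\<Sum>j\<in>UNIV. W $ i $ j * - aug_partial l (\<lambda>w. g w $ j) z)
       + cnj (- aug_partial (conj_index l) (aug_partial k (\<lambda>w. g w $ i)) z) * (\<Sum>j\<in>UNIV. W $ i $ j * (y $ j - g z $ j))))"
    (is "_ = ?rhs")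
proof -
  have "cnj (aug_partial k (lsq_loss W y g) w) = aug_partial (conj_index k) (lsq_loss W y g) w" for w
  proof -
    have "has_aug_partial k (lsq_loss W y g) (aug_partial k (lsq_loss W y g) w) w"
      by (rule has_aug_partial_works[OF has_aug_partial_lsq_loss[OF g]])
    then have "has_aug_partial (conj_index k) (\<lambda>w. cnj (lsq_loss W y g w))
        (cnj (aug_partial k (lsq_loss W y g) w)) w"
      by (intro has_aug_partial_cnj) simp
    then show ?thesis
      unfolding cnj_lsq_loss[OF W] by (rule has_aug_partial_imp_eq[symmetric])
  qed
  also have "aug_partial (conj_index k) (lsq_loss W y g) w =
    (1/2) * (\<Sum>i\<in>UNIV. cnj (y $ i - g w $ i) * (\<Sum>j\<in>UNIV. W $ i $ j * - aug_partial (conj_index k) (\<lambda>w. g w $ j) w)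
       + cnj (- aug_partial k (\<lambda>w. g w $ i) w) * (\<Sum>j\<in>UNIV. W $ i $ j * (y $ j - g w $ j)))" for w
    by (simp only: has_aug_partial_imp_eq[OF has_aug_partial_lsq_loss[OF g]] conj_index_simps)
  \<comment> \<open>An identity of functions is needed here, since the outer derivative sees values
    away from \<open>z\<close>.\<close>
  finally have grad: "(\<lambda>w. cnj (aug_partial k (lsq_loss W y g) w)) = (\<lambda>w. (1/2) * (\<Sum>i\<in>UNIV.
      cnj (y $ i - g w $ i) * (\<Sum>j\<in>UNIV. W $ i $ j * - aug_partial (conj_index k) (\<lambda>w. g w $ j) w)
       + cnj (- aug_partial k (\<lambda>w. g w $ i) w) * (\<Sum>j\<in>UNIV. W $ i $ j * (y $ j - g w $ j))))"
    by (rule ext)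
  show ?thesis
    unfolding aug_hessian_nth grad
    by (intro has_aug_partial_imp_eq has_aug_partial_add has_aug_partial_mult has_aug_partial_intros
        has_aug_partial_sum has_aug_partial_analytic has_aug_partial_aug_partial(1) finite g)
qed

section \<open>The Gauss-Newton matrix and the assembly of the Hessian\<close>

lemma gauss_newton_nth:
  "(ctranspose (aug_jacobian g z) ** W ** aug_jacobian g z) $ k $ l
    = (\<Sum>i\<in>UNIV. cnj (aug_partial k (\<lambda>w. g w $ i) z) * (\<Sum>j\<in>UNIV. W $ i $ j * aug_partial l (\<lambda>w. g w $ j) z))"
  \<comment> \<open>Bracketing \<open>W\<close> with the right factor yields the nested sums that
    occur in the Hessian of the loss.\<close>
  unfolding matrix_mul_assoc[symmetric]
  by (simp add: matrix_matrix_mult_def ctranspose_def transpose_def mat_cnj_def aug_jacobian_def)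

text \<open>G^H W G is Hermitian along with W. The product rule produces its entry at (l', k'),
  while P asks for the conjugate of the entry at (k', l').\<close>

lemma cnj_gauss_newton_nth:
  assumes "hermitian W"
  shows "cnj ((ctranspose (aug_jacobian g z) ** W ** aug_jacobian g z) $ k $ l)
    = (ctranspose (aug_jacobian g z) ** W ** aug_jacobian g z) $ l $ k"
  using sum_hermitian_swap[OF assms, of "\<chi> i. aug_partial l (\<lambda>w. g w $ i) z" "\<lambda>j. aug_partial k (\<lambda>w. g w $ j) z"]
  by (simp add: gauss_newton_nth matrix_vector_mult_def mult.commute)

lemma aug_hessian_lsq_loss:
  assumes g: "\<And>w i. real_analytic_at (\<lambda>w. g w $ i) w" and W: "hermitian W"
  shows "aug_hessian (lsq_loss W y g) z
    = proj_P (ctranspose (aug_jacobian g z) ** W ** aug_jacobian g z) - (\<Sum>i\<in>UNIV. residual_hessian W y g i z)"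
  unfolding vec_eq_iff
proof (intro allI)
  fix k l
  let ?e = "residual y g z"
  let ?H = "\<lambda>i. cnj (aug_partial (conj_index l) (aug_partial k (\<lambda>w. g w $ i)) z)"
  let ?H' = "\<lambda>i. aug_partial l (aug_partial (conj_index k) (\<lambda>w. g w $ i)) z"
  let ?M = "ctranspose (aug_jacobian g z) ** W ** aug_jacobian g z"
  \<comment> \<open>The signs from e = y - g cancel in the two first-order sums; one survives in
    each second-order sum.\<close>
  have "aug_hessian (lsq_loss W y g) z $ k $ l = (1/2) *
      (- (\<Sum>i\<in>UNIV. cnj (?e $ i) * (\<Sum>j\<in>UNIV. W $ i $ j * ?H' j))
       + (\<Sum>i\<in>UNIV. cnj (aug_partial (conj_index l) (\<lambda>w. g w $ i) z) * (\<Sum>j\<in>UNIV. W $ i $ j * aug_partial (conj_index k) (\<lambda>w. g w $ j) z))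
       + ((\<Sum>i\<in>UNIV. cnj (aug_partial k (\<lambda>w. g w $ i) z) * (\<Sum>j\<in>UNIV. W $ i $ j * aug_partial l (\<lambda>w. g w $ j) z))
       - (\<Sum>i\<in>UNIV. (W *v ?e) $ i * ?H i)))"
    unfolding aug_hessian_lsq_loss_nth[OF g W]
    by (simp add: sum.distrib sum_negf sum_subtractf residual_def matrix_vector_mult_def mult.commute)
  \<comment> \<open>Hermitian symmetry moves \<open>W\<close> onto the residual in the first sum,
    making its coefficients the conjugates of those in the last.\<close>
  also have "\<dots> = (1/2) * (?M $ k $ l + cnj (?M $ conj_index k $ conj_index l))
      - (1/2) * (\<Sum>i\<in>UNIV. (W *v ?e) $ i * ?H i + cnj ((W *v ?e) $ i) * ?H' i)"
    unfolding sum_hermitian_swap[OF W] gauss_newton_nth[symmetric] cnj_gauss_newton_nth[OF W]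
    by (simp add: sum.distrib algebra_simps)
  also have "\<dots> = (proj_P ?M - (\<Sum>i\<in>UNIV. residual_hessian W y g i z)) $ k $ l"
    by (simp add: proj_P_nth residual_hessian_nth[OF g] sum_distrib_left)
  finally show "aug_hessian (lsq_loss W y g) z $ k $ l
      = (proj_P ?M - (\<Sum>i\<in>UNIV. residual_hessian W y g i z)) $ k $ l" .
qed

theorem mainTheorem7:
  fixes g :: "complex ^ 'n \<Rightarrow> complex ^ 'm"
    and y :: "complex ^ 'm"
    and W :: "complex ^ 'm ^ 'm"
  assumes "real_analytic_on g UNIV"
    and "hermitian_pos_def W"
  shows "\<forall>z. aug_hessian (lsq_loss W y g) z
             = proj_P (ctranspose (aug_jacobian g z) ** W ** aug_jacobian g z)
               - (\<Sum>i\<in>UNIV. residual_hessian W y g i z)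
           \<and> (\<forall>i. hermitian (residual_hessian W y g i z)
                 \<and> (\<forall>v\<in>aug_space. residual_hessian W y g i z *v v \<in> aug_space))"
proof (intro allI conjI ballI)
  have g: "real_analytic_at (\<lambda>w. g w $ i) z" for i z
    using assms(1) real_analytic_at_bounded_linear[of g z, OF _ bounded_linear_vec_nth]
    by (simp add: real_analytic_on_def)
  have W: "hermitian W"
    using assms(2) unfolding hermitian_pos_def_def by blast
  fix z i and v :: "complex ^ ('n + 'n)"
  show "aug_hessian (lsq_loss W y g) z
      = proj_P (ctranspose (aug_jacobian g z) ** W ** aug_jacobian g z)
        - (\<Sum>i\<in>UNIV. residual_hessian W y g i z)"
    by (rule aug_hessian_lsq_loss[OF g W])
  show "hermitian (residual_hessian W y g i z)"
    by (rule residual_hessian_hermitian[OF g])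
  assume "v \<in> aug_space"
  \<comment> \<open>A residual Hessian is a value of \<open>proj_P\<close>, and all such values
    preserve the space.\<close>
  then show "residual_hessian W y g i z *v v \<in> aug_space"
    unfolding residual_hessian_def by (rule proj_P_mult_aug_space)
qed

end
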